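(* Let $(\mathcal X,\mathcal B,\mathbb P,f)$, the observable $\varphi$ with global maximum at $\zeta\in\mathcal X$, and the process $X_n=\varphi\circ f^n$ be as in the context, including the regularity assumptions (R1) and (R2) stated there. Assume that the system has decay of correlations of observables in a Banach space $\mathcal C$ against observables in $L^1(\mathbb P)$ with rate function $\gamma:\mathbb N\to\mathbb R$, and that there exists $\delta>0$ such that $n^{1+\delta}\gamma(n)\to0$ as $n\to\infty$. Let $\tau>0$ and let $(u_n)_{n\in\mathbb N}$ be such that $n\,\mathbb P(X_0>u_n)\to\tau$ as $n\to\infty$. Assume that there exists $q\in\mathbb N_0$ given by $$q:=\min\left\{j\in\mathbb N_0:\lim_{n\to\infty}R(A_n^{(j)})=\infty\right\}.$$ For each $n$ let $A_n:=A_n^{(q)}$, $R_n:=R(A_n^{(q)})$, and let $k_n,t_n\in\mathbb N$ with $k_nt_n<n$ be such that $$\begin{aligned}&k_nt_n\mathbb P(A_n)+n\gamma(t_n)\left(1+\frac{n\mathbb P(A_n)}{k_n}\right)+\frac{(n\mathbb P(A_n))^2}{k_n}\\&\qquad=\inf_{k,t\in\mathbb N:\,kt<n}\left\{kt\,\mathbb P(A_n)+n\gamma(t)\left(1+\frac{n\mathbb P(A_n)}{k}\right)+\frac{(n\mathbb P(A_n))^2}{k}\right\}.\end{aligned}$$ Assume that $\mathbf 1_{A_n}\in\mathcal C$ and that there exists $M>0$ such that $\|\mathbf 1_{A_n}\|_{\mathcal C}\le M$ for all $n\in\mathbb N$. Then there exists $C>0$ such that for all $n$ large $$\left|\mathbb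 P(M_n\le u_n)-e^{-\theta\tau}\right|\le Ce^{-\theta\tau}\left(\left|\theta\tau-n\mathbb P(A_n)\right|+k_nt_n\frac{\theta\tau}{n}+n\gamma(t_n)\left(1+\frac{\theta\tau}{k_n}\right)+\frac{(\theta\tau)^2}{k_n}+\theta\tau\sum_{j=R_n}^{\ell_n-1}\gamma(j)\right),$$ where $\ell_n=\lfloor n/k_n\rfloor-t_n$ and $\theta=\lim_{n\to\infty}\mathbb P(A_n^{(q)})/\mathbb P(U_n)$.
   Context: $\mathbb N=\{1,2,\ldots\}$, $\mathbb N_0=\mathbb N\cup\{0\}$. $\mathcal X$ is a Riemannian manifold, $\mathcal B$ its Borel $\sigma$-algebra, $f:\mathcal X\to\mathcal X$ measurable, and $\mathbb P$ an $f$-invariant probability measure on $\mathcal B$. $f^{-i}$ denotes preimage under $f^i$; $\mathbf 1_A$ is the indicator function of $A$. Decay of correlations against $L^1$: $\mathcal C$ is a Banach space of real-valued measurable functions on $\mathcal X$ and $\gamma:\mathbb N\to\mathbb R$ is a non-increasing function with $\gamma(n)\to0$ such that for all nonzero $\phi\in\mathcal C$, $\psi\in L^1(\mathbb P)$ and all $n\in\mathbb N$, $$\frac{1}{\|\phi\|_{\mathcal C}\|\psi\|_{1}}\left|\int\phi\,(\psi\circ f^n)\,d\mathbb P-\int\phi\,d\mathbb P\int\psi\,d\mathbb P\right|\le\gamma(n).$$ Process: $\varphi:\mathcal X\to\mathbb R\cup\{\pm\infty\}$ is measurable and achieves a global maximum at $\zeta\in\mathcal X$ ($\varphi(\zeta)=+\infty$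 allowed); $X_n=\varphi\circ f^n$, $n\in\mathbb N_0$; $M_n=\max\{X_0,\ldots,X_{n-1}\}$; $u_F=\varphi(\zeta)$. Events: $U(u)=\{x:\varphi(x)>u\}=\{X_0>u\}$; $A^{(0)}(u)=U(u)$; for $j\ge1$, $A^{(j)}(u)=U(u)\cap\bigcap_{i=1}^jf^{-i}(U(u)^c)$; $U_n=U(u_n)$, $A_n^{(j)}=A^{(j)}(u_n)$. First return time: for $A\in\mathcal B$, $r_A(x)=\min\{j\in\mathbb N\cup\{+\infty\}:f^j(x)\in A\}$ ($=+\infty$ if the orbit never enters $A$ at a positive time), and $R(A)=\inf_{x\in A}r_A(x)$. A point $\zeta$ is periodic of prime period $p$ if $f^p(\zeta)=\zeta$ and $f^j(\zeta)\ne\zeta$ for $j=1,\ldots,p-1$. Standing assumptions: (R1) For $u$ sufficiently close to $u_F$, the set $U(u)$ is homeomorphic to an open ball centred at $\zeta$, and $u\mapsto\mathbb P(U(u))$ is continuous on a neighbourhood of $u_F$. (R2) If $\zeta$ is a periodic point of prime period $p\in\mathbb N$, then for all $u$ sufficiently close to $u_F$: $U(u)\cap f^{-p}(U(u))\ne\emptyset$; $U(u)\cap f^{-j}(U(u))=\emptyset$ for $j=1,\ldots,p-1$; $\bigcap_{k\ge0}f^{-kp}(U(u))=\{\zeta\}$; and there exists $0<\theta<1$ such that $\mathbb P(U(u)\cap f^{-p}(U(u)))\sim(1-\theta)\mathbb P(U(u))$ as $u\to u_F$. The limit defining $\theta$ in the claim is supposed to exist. Sums over an empty index range are $0$. The choice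 of $k_n,t_n$ is made for $n\ge2$, so that the set over which the infimum is taken is nonempty.
   Formalization: The formal theorem additionally assumes that the limit θ is strictly positive (for θ = 0 the claimed bound can fail, its right-hand side being zero while P(M_n ≤ u_n) < 1), and takes the manifold to have positive dimension. *)

theory Defs
  imports "HOL-Probability.Probability" "HOL-Library.Landau_Symbols"
begin

section \<open>Riemannian manifolds\<close>

text \<open>The manifold is the whole type \<open>'a\<close>, a second countable Hausdorff space; a chart is a pair of
  its domain and its coordinate map into the Euclidean model space \<open>'e\<close>. The manifold is not
  required to be connected.\<close>

type_synonym ('a, 'e) chart = "'a set \<times> ('a \<Rightarrow> 'e)"

text \<open>\<open>Ck_on k h S\<close> is meant for open \<open>S\<close>; all directional derivatives of order up to \<open>k\<close>
  exist and are continuous.\<close>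

primrec Ck_on ::
  "nat \<Rightarrow> ('e::euclidean_space \<Rightarrow> 'f::real_normed_vector) \<Rightarrow> 'e set \<Rightarrow> bool" where
  "Ck_on 0 h S \<longleftrightarrow> continuous_on S h"
| "Ck_on (Suc k) h S \<longleftrightarrow>
     h differentiable_on S \<and> (\<forall>v. Ck_on k (\<lambda>x. frechet_derivative h (at x) v) S)"

definition smooth_map_on ::
  "('e::euclidean_space \<Rightarrow> 'f::real_normed_vector) \<Rightarrow> 'e set \<Rightarrow> bool" where
  "smooth_map_on h S \<longleftrightarrow> (\<forall>k. Ck_on k h S)"

definition transition ::
  "('a, 'e) chart \<Rightarrow> ('a, 'e) chart \<Rightarrow> 'e \<Rightarrow> 'e" where
  "transition c c' = snd c' \<circ> inv_into (fst c) (snd c)"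

definition smooth_atlas ::
  "('a::topological_space, 'e::euclidean_space) chart set \<Rightarrow> bool" where
  "smooth_atlas A \<longleftrightarrow>
     (\<Union>c\<in>A. fst c) = UNIV \<and>
     (\<forall>c\<in>A. open (fst c) \<and> open (snd c ` fst c) \<and>
        (\<exists>y. homeomorphism (fst c) (snd c ` fst c) (snd c) y)) \<and>
     (\<forall>c\<in>A. \<forall>c'\<in>A. smooth_map_on (transition c c') (snd c ` (fst c \<inter> fst c')))"

text \<open>A Riemannian metric is given in coordinates: \<open>g c p v w\<close> is the inner product, at the point
  \<open>p\<close> of the domain of the chart \<open>c\<close>, of the two tangent vectors whose coordinates with respect
  to \<open>c\<close> are \<open>v\<close> and \<open>w\<close>. The last clause is the transformation law under a change of chart.\<close>

definition riemannian_metric ::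
  "('a::topological_space, 'e::euclidean_space) chart set \<Rightarrow>
   (('a, 'e) chart \<Rightarrow> 'a \<Rightarrow> 'e \<Rightarrow> 'e \<Rightarrow> real) \<Rightarrow> bool" where
  "riemannian_metric A g \<longleftrightarrow>
     (\<forall>c\<in>A. \<forall>p\<in>fst c. bilinear (g c p) \<and> (\<forall>v w. g c p v w = g c p w v) \<and>
        (\<forall>v. v \<noteq> 0 \<longrightarrow> 0 < g c p v v)) \<and>
     (\<forall>c\<in>A. \<forall>v w. smooth_map_on (\<lambda>z. g c (inv_into (fst c) (snd c) z) v w) (snd c ` fst c)) \<and>
     (\<forall>c\<in>A. \<forall>c'\<in>A. \<forall>p\<in>fst c \<inter> fst c'. \<forall>v w.
        g c p v w = g c' p (frechet_derivative (transition c c') (at (snd c p)) v)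
                           (frechet_derivative (transition c c') (at (snd c p)) w))"

definition riemannian_manifold ::
  "('a::{t2_space, second_countable_topology}, 'e::euclidean_space) chart set \<Rightarrow>
   (('a, 'e) chart \<Rightarrow> 'a \<Rightarrow> 'e \<Rightarrow> 'e \<Rightarrow> real) \<Rightarrow> bool" where
  "riemannian_manifold A g \<longleftrightarrow> smooth_atlas A \<and> riemannian_metric A g"

definition piecewise_C1_curve ::
  "('a::topological_space, 'e::euclidean_space) chart set \<Rightarrow> (real \<Rightarrow> 'a) \<Rightarrow> bool" where
  "piecewise_C1_curve A \<sigma> \<longleftrightarrow> continuous_on {0..1} \<sigma> \<and>
     (\<exists>S. finite S \<and>
       (\<forall>c\<in>A. (snd c \<circ> \<sigma>) C1_differentiable_on ({t\<in>{0<..<1}. \<sigma> t \<in> fst c} - S)))"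

text \<open>By the transformation law the speed does not depend on the chart selected here.\<close>

definition curve_speed ::
  "('a, 'e::euclidean_space) chart set \<Rightarrow> (('a, 'e) chart \<Rightarrow> 'a \<Rightarrow> 'e \<Rightarrow> 'e \<Rightarrow> real) \<Rightarrow>
   (real \<Rightarrow> 'a) \<Rightarrow> real \<Rightarrow> real" where
  "curve_speed A g \<sigma> t =
     (let c = (SOME c. c \<in> A \<and> \<sigma> t \<in> fst c);
          v = vector_derivative (snd c \<circ> \<sigma>) (at t)
      in sqrt (g c (\<sigma> t) v v))"

definition curve_length ::
  "('a, 'e::euclidean_space) chart set \<Rightarrow> (('a, 'e) chart \<Rightarrow> 'a \<Rightarrow> 'e \<Rightarrow> 'e \<Rightarrow> real) \<Rightarrow>
   (real \<Rightarrow> 'a) \<Rightarrow> ennreal" where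
  "curve_length A g \<sigma> = (\<integral>\<^sup>+t\<in>{0..1}. ennreal (curve_speed A g \<sigma> t) \<partial>lborel)"

text \<open>The distance of points in different connected components is \<open>\<infinity>\<close>.\<close>

definition riemannian_dist ::
  "('a::topological_space, 'e::euclidean_space) chart set \<Rightarrow>
   (('a, 'e) chart \<Rightarrow> 'a \<Rightarrow> 'e \<Rightarrow> 'e \<Rightarrow> real) \<Rightarrow> 'a \<Rightarrow> 'a \<Rightarrow> ennreal" where
  "riemannian_dist A g p q =
     (INF \<sigma>\<in>{\<sigma>. piecewise_C1_curve A \<sigma> \<and> \<sigma> 0 = p \<and> \<sigma> 1 = q}. curve_length A g \<sigma>)"

definition riemannian_ball ::
  "('a::topological_space, 'e::euclidean_space) chart set \<Rightarrow>
   (('a, 'e) chart \<Rightarrow> 'a \<Rightarrow> 'e \<Rightarrow> 'e \<Rightarrow> real) \<Rightarrow> 'a \<Rightarrow> real \<Rightarrow> 'a set" where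
  "riemannian_ball A g p r = {q. riemannian_dist A g p q < ennreal r}"


section \<open>Decay of correlations\<close>

text \<open>A Banach space \<open>C\<close> of real-valued measurable functions with norm \<open>N\<close>. Functions of norm
  zero are only required to vanish almost everywhere, so that spaces whose elements are
  honest functions and spaces of functions modulo almost everywhere equality are both covered;
  accordingly \<open>N \<phi> \<noteq> 0\<close> expresses that \<open>\<phi>\<close> is a nonzero element.\<close>

definition banach_function_space ::
  "'a measure \<Rightarrow> ('a \<Rightarrow> real) set \<Rightarrow> (('a \<Rightarrow> real) \<Rightarrow> real) \<Rightarrow> bool" where
  "banach_function_space P C N \<longleftrightarrow>
     C \<subseteq> borel_measurable P \<and>
     (\<lambda>x. 0) \<in> C \<and>
     (\<forall>\<phi>\<in>C. \<forall>\<psi>\<in>C. (\<lambda>x. \<phi> x + \<psi> x) \<in> C \<and> N (\<lambda>x. \<phi> x + \<psi> x) \<le> N \<phi> + N \<psi>) \<and>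
     (\<forall>c. \<forall>\<phi>\<in>C. (\<lambda>x. c * \<phi> x) \<in> C \<and> N (\<lambda>x. c * \<phi> x) = \<bar>c\<bar> * N \<phi>) \<and>
     (\<forall>\<phi>\<in>C. 0 \<le> N \<phi>) \<and>
     (\<forall>\<phi>\<in>C. N \<phi> = 0 \<longrightarrow> (AE x in P. \<phi> x = 0)) \<and>
     (\<forall>F::nat \<Rightarrow> 'a \<Rightarrow> real.
        (\<forall>n. F n \<in> C) \<and>
        (\<forall>e>0. \<exists>K. \<forall>m\<ge>K. \<forall>n\<ge>K. N (\<lambda>x. F m x - F n x) < e) \<longrightarrow>
        (\<exists>\<phi>\<in>C. (\<lambda>n. N (\<lambda>x. F n x - \<phi> x)) \<longlonglongrightarrow> 0))"

text \<open>The rate function is defined on the positive integers, so \<open>\<gamma> 0\<close> is irrelevant. The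
  integrability clauses say that the integrals in the correlation are meaningful.\<close>

definition decay_of_correlations_L1 ::
  "'a measure \<Rightarrow> ('a \<Rightarrow> 'a) \<Rightarrow> ('a \<Rightarrow> real) set \<Rightarrow> (('a \<Rightarrow> real) \<Rightarrow> real) \<Rightarrow> (nat \<Rightarrow> real) \<Rightarrow> bool"
where
  "decay_of_correlations_L1 P f C N \<gamma> \<longleftrightarrow>
     banach_function_space P C N \<and>
     (\<forall>m n. 1 \<le> m \<and> m \<le> n \<longrightarrow> \<gamma> n \<le> \<gamma> m) \<and>
     \<gamma> \<longlonglongrightarrow> 0 \<and>
     (\<forall>\<phi> \<psi> n. \<phi> \<in> C \<and> N \<phi> \<noteq> 0 \<and> integrable P \<psi> \<and> (LINT x|P. \<bar>\<psi> x\<bar>) \<noteq> 0 \<and> 1 \<le> n \<longrightarrow>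
        integrable P \<phi> \<and> integrable P (\<lambda>x. \<phi> x * \<psi> ((f ^^ n) x)) \<and>
        1 / (N \<phi> * (LINT x|P. \<bar>\<psi> x\<bar>)) *
          \<bar>(LINT x|P. \<phi> x * \<psi> ((f ^^ n) x)) - (LINT x|P. \<phi> x) * (LINT x|P. \<psi> x)\<bar> \<le> \<gamma> n)"


section \<open>Exceedances, maxima and return times\<close>

definition exceedance :: "('a \<Rightarrow> ereal) \<Rightarrow> ereal \<Rightarrow> 'a set" where
  "exceedance \<phi> u = {x. \<phi> x > u}"

definition escape_set :: "('a \<Rightarrow> 'a) \<Rightarrow> ('a \<Rightarrow> ereal) \<Rightarrow> nat \<Rightarrow> ereal \<Rightarrow> 'a set" where
  "escape_set f \<phi> j u = exceedance \<phi> u \<inter> (\<Inter>i\<in>{1..j}. (f ^^ i) -` (- exceedance \<phi> u))"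

text \<open>Used for \<open>n \<ge> 1\<close> only.\<close>

definition running_max :: "('a \<Rightarrow> 'a) \<Rightarrow> ('a \<Rightarrow> ereal) \<Rightarrow> nat \<Rightarrow> 'a \<Rightarrow> ereal" where
  "running_max f \<phi> n x = Max ((\<lambda>i. \<phi> ((f ^^ i) x)) ` {..<n})"

text \<open>The infimum of the empty subset of \<open>enat\<close> is \<open>\<infinity>\<close>.\<close>

definition hitting_time :: "('a \<Rightarrow> 'a) \<Rightarrow> 'a set \<Rightarrow> 'a \<Rightarrow> enat" where
  "hitting_time f A x = (INF j\<in>{j. 1 \<le> j \<and> (f ^^ j) x \<in> A}. enat j)"

definition first_return :: "('a \<Rightarrow> 'a) \<Rightarrow> 'a set \<Rightarrow> enat" where
  "first_return f A = (INF x\<in>A. hitting_time f A x)"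


section \<open>Regularity assumptions\<close>

definition prime_period :: "('a \<Rightarrow> 'a) \<Rightarrow> 'a \<Rightarrow> nat \<Rightarrow> bool" where
  "prime_period f z p \<longleftrightarrow> 1 \<le> p \<and> (f ^^ p) z = z \<and> (\<forall>j\<in>{1..<p}. (f ^^ j) z \<noteq> z)"

text \<open>``For \<open>u\<close> sufficiently close to \<open>\<phi> \<zeta>\<close>'' refers to levels below the maximum \<open>\<phi> \<zeta>\<close>, above which
  there are no exceedances; neighbourhoods are taken in the extended reals, as \<open>\<phi> \<zeta> = \<infinity>\<close> is
  allowed.\<close>

definition regularity_R1 ::
  "('a::topological_space, 'e::euclidean_space) chart set \<Rightarrow>
   (('a, 'e) chart \<Rightarrow> 'a \<Rightarrow> 'e \<Rightarrow> 'e \<Rightarrow> real) \<Rightarrow> 'a measure \<Rightarrow> ('a \<Rightarrow> ereal) \<Rightarrow> 'a \<Rightarrow> bool" where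
  "regularity_R1 A g P \<phi> \<zeta> \<longleftrightarrow>
     (\<forall>\<^sub>F u in at_left (\<phi> \<zeta>).
        \<exists>r>0. exceedance \<phi> u homeomorphic riemannian_ball A g \<zeta> r) \<and>
     (\<exists>V. open V \<and> \<phi> \<zeta> \<in> V \<and> continuous_on V (\<lambda>u. measure P (exceedance \<phi> u)))"

definition regularity_R2 ::
  "'a measure \<Rightarrow> ('a \<Rightarrow> 'a) \<Rightarrow> ('a \<Rightarrow> ereal) \<Rightarrow> 'a \<Rightarrow> bool" where
  "regularity_R2 P f \<phi> \<zeta> \<longleftrightarrow>
     (\<forall>p. prime_period f \<zeta> p \<longrightarrow>
        (\<forall>\<^sub>F u in at_left (\<phi> \<zeta>).
           exceedance \<phi> u \<inter> (f ^^ p) -` exceedance \<phi> u \<noteq> {} \<and>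
           (\<forall>j\<in>{1..<p}. exceedance \<phi> u \<inter> (f ^^ j) -` exceedance \<phi> u = {}) \<and>
           (\<Inter>k. (f ^^ (k * p)) -` exceedance \<phi> u) = {\<zeta>}) \<and>
        (\<exists>\<theta>. 0 < \<theta> \<and> \<theta> < 1 \<and>
           (\<lambda>u. measure P (exceedance \<phi> u \<inter> (f ^^ p) -` exceedance \<phi> u))
             \<sim>[at_left (\<phi> \<zeta>)] (\<lambda>u. (1 - \<theta>) * measure P (exceedance \<phi> u))))"


section \<open>The functional minimised by the block parameters\<close>

definition block_cost :: "(nat \<Rightarrow> real) \<Rightarrow> nat \<Rightarrow> real \<Rightarrow> nat \<Rightarrow> nat \<Rightarrow> real" where
  "block_cost \<gamma> n a k t =
     real (k * t) * a + real n * \<gamma> t * (1 + real n * a / real k) + (real n * a)\<^sup>2 / real k"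

end

theory Submission
  imports Defs
begin

text \<open>Up to an error \<open>q * P(U\<^sub>n) = O(1/n)\<close>, which the term \<open>k\<^sub>n t\<^sub>n \<theta> \<tau> / n\<close> absorbs, the maximum stays
  below \<open>u\<^sub>n\<close> up to time \<open>n\<close> iff the orbit avoids the escape set \<open>A\<^sub>n\<close>. Time is cut into \<open>k\<^sub>n\<close> blocks,
  each made of \<open>l\<^sub>n\<close> observed steps and a gap \<open>t\<^sub>n\<close>. One more block multiplies the probability of
  avoidance by about \<open>1 - l\<^sub>n P(A\<^sub>n)\<close>: each single visit is decoupled from the future by decay of
  correlations across the gap, and two visits in one block are unlikely, being impossible
  before the first return time and decorrelated after it. Iterating gives
  \<open>(1 - l\<^sub>n P(A\<^sub>n)) ^ k\<^sub>n\<close>, which is compared with \<open>exp (- \<theta> * \<tau>)\<close>.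

  If \<open>k\<^sub>n < n P(A\<^sub>n)\<close>, this number may fail to be a probability, but then the term \<open>(\<theta> \<tau>)\<^sup>2 / k\<^sub>n\<close> alone
  exceeds a constant.\<close>

section \<open>Elementary bounds for return times and exponentials\<close>

text \<open>Return times count from 1, so a sum over lags from the first return on never meets
  \<open>\<gamma> 0\<close>, whose value is arbitrary.\<close>

lemma one_le_first_return: "1 \<le> first_return f A"
  unfolding first_return_def hitting_time_def by (auto intro!: INF_greatest simp: one_enat_def)

text \<open>Powers of two numbers in [0, 1] differ by at most \<open>k\<close> times the difference
  of the bases; here the bases agree to first order in \<open>x\<close>.\<close>

lemma power_exp_diff:
  fixes x :: real
  assumes "0 \<le> x" "x \<le> 1"
  shows "\<bar>(1 - x) ^ k - exp (- (k * x))\<bar> \<le> k * x\<^sup>2"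
proof -
  have "\<bar>(1 - x) ^ k - exp (- x) ^ k\<bar> \<le> k * \<bar>(1 - x) - exp (- x)\<bar>"
    using norm_power_diff[of "1 - x" "exp (- x)" k] assms by simp
  also have "\<bar>(1 - x) - exp (- x)\<bar> \<le> x\<^sup>2"
  proof -
    have lower: "1 - x \<le> exp (- x)" using exp_ge_add_one_self[of "- x"] by simp
    have "exp (- x) * (1 + x) \<le> exp (- x) * exp x"
      by (intro mult_left_mono) auto
    then have "exp (- x) * (1 + x) \<le> 1" by (simp flip: exp_add)
    \<comment> \<open>The product equals \<open>1 + x ^ 3\<close>.\<close>
    moreover have "1 \<le> (1 - x + x\<^sup>2) * (1 + x)"
      using assms by (simp add: algebra_simps power2_eq_square)
    ultimately have "exp (- x) \<le> 1 - x + x\<^sup>2"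
      using assms by (smt (verit) mult_right_le_imp_le)
    then show ?thesis using lower by simp
  qed
  finally show ?thesis
    by (simp add: mult_left_mono exp_of_nat_mult[symmetric])
qed

lemma exp_neg_diff:
  fixes x y :: real
  assumes "0 \<le> x" "0 \<le> y"
  shows "\<bar>exp (- x) - exp (- y)\<bar> \<le> \<bar>x - y\<bar>"
proof -
  have "exp (- a) - exp (- b) \<le> b - a" if "0 \<le> a" "a \<le> b" for a b :: real
  proof -
    have "exp (- a) - exp (- b) = exp (- a) * (1 - exp (a - b))"
      by (simp add: algebra_simps flip: exp_add)
    also have "\<dots> \<le> 1 * (1 - exp (a - b))"
      using that by (intro mult_right_mono) auto
    also have "\<dots> \<le> b - a" using exp_ge_add_one_self[of "a - b"] unfolding mult_1_left by linarith
    finally show ?thesis .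
  qed
  then show ?thesis using assms
    by (cases "x \<le> y") (smt (verit) exp_le_cancel_iff)+
qed

section \<open>Invariant dynamics and orbits avoiding a set, block by block\<close>

locale measure_preserving_map = prob_space P for P :: "'a measure" +
  fixes f :: "'a \<Rightarrow> 'a"
  assumes space_UNIV: "space P = UNIV"
    and f_meas: "f \<in> measurable P P"
    and f_inv: "distr P P f = P"
begin

lemma funpow_measurable [measurable]: "f ^^ n \<in> measurable P P"
proof (induction n)
  case (Suc n)
  then show ?case
    using measurable_comp[OF Suc f_meas] by (simp add: o_def)
qed (simp add: id_def)

lemma vimage_funpow_sets [measurable, intro]: "E \<in> sets P \<Longrightarrow> (f ^^ n) -` E \<in> sets P"
  using measurable_sets[OF funpow_measurable] by (simp add: space_UNIV)

lemma prob_vimage_funpow [simp]: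
  assumes "E \<in> sets P"
  shows "prob ((f ^^ n) -` E) = prob E"
proof (induction n)
  case (Suc n)
  have "prob ((f ^^ Suc n) -` E) = prob (f -` ((f ^^ n) -` E))"
    by (simp only: funpow_Suc_right vimage_comp)
  also have "\<dots> = measure (distr P P f) ((f ^^ n) -` E)"
    using f_meas assms by (simp add: measure_distr vimage_funpow_sets space_UNIV)
  finally show ?case
    by (simp only: f_inv Suc)
qed simp

text \<open>Used for two sets: for the exceedance set this is the event that the maximum stays below
  the level, for the escape set its approximation.\<close>

definition avoid :: "'a set \<Rightarrow> nat \<Rightarrow> 'a set" where
  "avoid A n = {x. \<forall>i<n. (f ^^ i) x \<notin> A}"

lemma avoid_0 [simp]: "avoid A 0 = UNIV"
  by (simp add: avoid_def)

lemma avoid_Suc: "avoid A (Suc n) = avoid A n - (f ^^ n) -` A"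
  by (auto simp: avoid_def less_Suc_eq)

lemma avoid_add: "avoid A (m + n) = avoid A m \<inter> (f ^^ m) -` avoid A n"
proof (induction n)
  case (Suc n)
  have "f ^^ (m + n) = (f ^^ n) \<circ> (f ^^ m)"
    by (simp only: add.commute[of m] funpow_add)
  then have "(f ^^ (m + n)) -` A = (f ^^ m) -` ((f ^^ n) -` A)"
    by (simp only: vimage_comp)
  then show ?case
    by (simp only: add_Suc_right avoid_Suc Suc vimage_Diff) blast
qed simp

lemma avoid_sets [measurable, intro]: "A \<in> sets P \<Longrightarrow> avoid A n \<in> sets P"
proof (induction n)
  case 0
  show ?case using sets.top[of P] by (simp add: space_UNIV)
qed (auto simp: avoid_Suc)

text \<open>By invariance each additional observed time removes at most \<open>prob A\<close>. This
  pays for the gap of a block (with \<open>G\<close> an event after the gap) and for the times left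
  over after the last block.\<close>

lemma prob_avoid_add:
  assumes A: "A \<in> sets P" and G: "G \<in> sets P"
  shows "prob (avoid A m \<inter> G) - n * prob A \<le> prob (avoid A (m + n) \<inter> G)"
    and "prob (avoid A (m + n) \<inter> G) \<le> prob (avoid A m \<inter> G)"
proof -
  show "prob (avoid A m \<inter> G) - n * prob A \<le> prob (avoid A (m + n) \<inter> G)"
  proof (induction n)
    case (Suc n)
    have "avoid A (m + n) \<inter> G \<subseteq> (avoid A (m + Suc n) \<inter> G) \<union> (f ^^ (m + n)) -` A"
      by (auto simp: avoid_Suc)
    then have "prob (avoid A (m + n) \<inter> G)
        \<le> prob ((avoid A (m + Suc n) \<inter> G) \<union> (f ^^ (m + n)) -` A)"
      using A G by (intro finite_measure_mono) auto
    also have "\<dots> \<le> prob (avoid A (m + Suc n) \<inter> G) + prob ((f ^^ (m + n)) -` A)"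
      using A G by (intro measure_Un_le) auto
    finally show ?case using Suc A by (simp add: algebra_simps)
  qed simp
  show "prob (avoid A (m + n) \<inter> G) \<le> prob (avoid A m \<inter> G)"
  proof (intro finite_measure_mono)
    show "avoid A (m + n) \<inter> G \<subseteq> avoid A m \<inter> G" by (auto simp: avoid_def)
  qed (use A G in auto)
qed

text \<open>The observed set \<open>A\<close> occurs before the arbitrary event \<open>D\<close>: this is the order for which decay
  of correlations against \<open>L\<^sup>1\<close> gives an error proportional to \<open>prob D\<close>.\<close>

lemma prob_avoid_block:
  assumes A: "A \<in> sets P" and D: "D \<in> sets P"
    and mix: "\<And>j. t < j \<Longrightarrow> \<bar>prob (A \<inter> (f ^^ j) -` D) - prob A * prob D\<bar> \<le> c"
    and S: "(\<Sum>j\<in>{1..<l}. prob (A \<inter> (f ^^ j) -` A)) \<le> S"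
    and "m \<le> l"
  shows "\<bar>prob (avoid A m \<inter> (f ^^ (l + t)) -` D) - (1 - m * prob A) * prob D\<bar> \<le> m * (c + S)"
  using \<open>m \<le> l\<close>
proof (induction m)
  case 0
  then show ?case using D by simp
next
  case (Suc m)
  define G where "G = (f ^^ (l + t)) -` D"
  have G: "G \<in> sets P" using D by (auto simp: G_def)
  \<comment> \<open>Invariance moves the earlier of the two times to 0, so only the lag
    matters.\<close>
  have pull: "prob ((f ^^ i) -` A \<inter> (f ^^ j) -` E) = prob (A \<inter> (f ^^ (j - i)) -` E)"
    if "i \<le> j" and E: "E \<in> sets P" for i j E
  proof -
    have j: "f ^^ j = (f ^^ (j - i)) \<circ> (f ^^ i)"
      using that by (simp flip: funpow_add)
    have "(f ^^ i) -` A \<inter> (f ^^ j) -` E = (f ^^ i) -` (A \<inter> (f ^^ (j - i)) -` E)"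
      unfolding j by auto
    moreover have "prob \<dots> = prob (A \<inter> (f ^^ (j - i)) -` E)"
      using A E by (intro prob_vimage_funpow) auto
    ultimately show ?thesis by simp
  qed
  \<comment> \<open>Observing time \<open>m\<close> as well loses exactly the part of
    \<open>H\<close> on which \<open>A\<close> was not visited before.\<close>
  define H where "H = (f ^^ m) -` A \<inter> G"
  have H: "H \<in> sets P" using A G by (auto simp: H_def)
  have "prob H = prob (A \<inter> (f ^^ (l + t - m)) -` D)"
    unfolding H_def G_def using Suc.prems by (intro pull D) simp
  \<comment> \<open>Since \<open>m < l\<close>, the lag \<open>l + t - m\<close> exceeds
    \<open>t\<close>: this is what the gap is for.\<close>
  then have H_bound: "\<bar>prob H - prob A * prob D\<bar> \<le> c"
    using mix[of "l + t - m"] Suc.prems by simp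
  have "prob (avoid A m \<inter> G) = prob (avoid A (Suc m) \<inter> G) + prob (avoid A m \<inter> H)"
    using A G H
    by (subst finite_measure_Union[symmetric]) (auto simp: avoid_Suc H_def intro!: arg_cong[of _ _ prob])
  moreover have "prob (avoid A m \<inter> H) \<le> prob H"
    using H by (intro finite_measure_mono) auto
  \<comment> \<open>The rest of \<open>H\<close> has two visits to \<open>A\<close> within the
    block, at times \<open>i < m\<close> and \<open>m\<close>; it is bounded by summing over the
    lags \<open>m - i\<close>.\<close>
  moreover have "prob H \<le> prob (avoid A m \<inter> H) + S"
  proof -
    have "prob H \<le> prob ((avoid A m \<inter> H) \<union> (\<Union>i<m. (f ^^ i) -` A \<inter> (f ^^ m) -` A))"
      using A H
    proof (intro finite_measure_mono)
      show "H \<subseteq> (avoid A m \<inter> H) \<union> (\<Union>i<m. (f ^^ i) -` A \<inter> (f ^^ m) -` A)"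
        by (auto simp: avoid_def H_def)
    qed auto
    also have "\<dots> \<le> prob (avoid A m \<inter> H) + prob (\<Union>i<m. (f ^^ i) -` A \<inter> (f ^^ m) -` A)"
      using A H by (intro measure_Un_le) auto
    also have "prob (\<Union>i<m. (f ^^ i) -` A \<inter> (f ^^ m) -` A)
        \<le> (\<Sum>i<m. prob ((f ^^ i) -` A \<inter> (f ^^ m) -` A))"
      using A by (intro finite_measure_subadditive_finite) auto
    also have "\<dots> = (\<Sum>i<m. prob (A \<inter> (f ^^ (m - i)) -` A))"
      using A by (intro sum.cong refl pull) auto
    also have "\<dots> = (\<Sum>j\<in>{1..m}. prob (A \<inter> (f ^^ j) -` A))"
      by (rule sum.reindex_bij_witness[of _ "\<lambda>j. m - j" "\<lambda>i. m - i"]) auto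
    also have "\<dots> \<le> (\<Sum>j\<in>{1..<l}. prob (A \<inter> (f ^^ j) -` A))"
      using Suc.prems by (intro sum_mono2) auto
    finally show ?thesis using S by simp
  qed
  moreover have "\<bar>prob (avoid A m \<inter> G) - (1 - m * prob A) * prob D\<bar> \<le> m * (c + S)"
    using Suc by (simp add: G_def)
  ultimately have "\<bar>prob (avoid A (Suc m) \<inter> G) - ((1 - m * prob A) * prob D - prob A * prob D)\<bar>
      \<le> m * (c + S) + (c + S)"
    using H_bound by linarith
  then show ?case by (simp add: G_def algebra_simps)
qed

text \<open>The factor \<open>1 - l * prob A\<close> lies in [0, 1], so the errors of the other
  blocks are not amplified and add up linearly in \<open>k\<close>.\<close>

lemma prob_avoid_blocks:
  assumes A: "A \<in> sets P" and "l * prob A \<le> 1"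
    and mix: "\<And>D j. D \<in> sets P \<Longrightarrow> t < j \<Longrightarrow>
      \<bar>prob (A \<inter> (f ^^ j) -` D) - prob A * prob D\<bar> \<le> c"
    and S: "(\<Sum>j\<in>{1..<l}. prob (A \<inter> (f ^^ j) -` A)) \<le> S"
  shows "\<bar>prob (avoid A (k * (l + t))) - (1 - l * prob A) ^ k\<bar>
    \<le> k * (t * prob A + l * (c + S))"
proof (induction k)
  case 0
  then show ?case using prob_space by (simp add: space_UNIV)
next
  case (Suc k)
  define D where "D = avoid A (k * (l + t))"
  define G where "G = (f ^^ (l + t)) -` D"
  define x where "x = 1 - l * prob A"
  have x: "0 \<le> x" "x \<le> 1" using assms(2) by (simp_all add: x_def)
  have D: "D \<in> sets P" and G: "G \<in> sets P" using A by (auto simp: D_def G_def)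
  \<comment> \<open>The new block goes in front: the other \<open>k\<close> blocks form the future
    event \<open>D\<close>, which is why \<open>mix\<close> has to be uniform in
    \<open>D\<close>.\<close>
  have "avoid A (Suc k * (l + t)) = avoid A (l + t) \<inter> G"
    unfolding G_def D_def using avoid_add[of A "l + t" "k * (l + t)"] by simp
  then have "prob (avoid A (Suc k * (l + t))) = prob (avoid A (l + t) \<inter> G)" by simp
  moreover have "\<bar>prob (avoid A (l + t) \<inter> G) - prob (avoid A l \<inter> G)\<bar> \<le> t * prob A"
    using prob_avoid_add[OF A G, of l t] by linarith
  moreover have "\<bar>prob (avoid A l \<inter> G) - x * prob D\<bar> \<le> l * (c + S)"
    unfolding G_def x_def by (rule prob_avoid_block[OF A D mix[OF D] S order_refl])
  moreover have "\<bar>x * prob D - x * x ^ k\<bar> \<le> k * (t * prob A + l * (c + S))"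
  proof -
    have "\<bar>x * prob D - x * x ^ k\<bar> = x * \<bar>prob D - x ^ k\<bar>"
      using x by (simp add: abs_mult flip: right_diff_distrib)
    also have "\<dots> \<le> \<bar>prob D - x ^ k\<bar>"
      using x by (simp add: mult_left_le_one_le)
    also have "\<dots> \<le> k * (t * prob A + l * (c + S))"
      using Suc by (simp add: D_def x_def)
    finally show ?thesis .
  qed
  ultimately have "\<bar>prob (avoid A (Suc k * (l + t))) - x * x ^ k\<bar>
      \<le> t * prob A + l * (c + S) + k * (t * prob A + l * (c + S))"
    by linarith
  also have "\<dots> = Suc k * (t * prob A + l * (c + S))"
    by (simp add: distrib_right)
  finally show ?case by (simp only: x_def power_Suc)
qed

section \<open>Maxima and escape sets\<close>

lemma exceedance_sets:
  assumes "\<phi> \<in> borel_measurable P"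
  shows "exceedance \<phi> u \<in> sets P"
  using measurable_sets[OF assms, of "{u<..}"]
  by (simp add: exceedance_def vimage_def space_UNIV)

lemma escape_set_sets:
  assumes "\<phi> \<in> borel_measurable P"
  shows "escape_set f \<phi> q u \<in> sets P"
proof -
  have "escape_set f \<phi> q u = exceedance \<phi> u - (\<Union>i\<in>{1..q}. (f ^^ i) -` exceedance \<phi> u)"
    by (auto simp: escape_set_def)
  then show ?thesis using exceedance_sets[OF assms] by auto
qed

text \<open>A point which exceeds \<open>u\<close> before time \<open>n\<close> but avoids the escape set does so only during the
  last \<open>q\<close> steps: the last exceedance would otherwise be an escape.\<close>

lemma prob_max_le_escape:
  fixes u :: ereal and q :: nat
  assumes phi: "\<phi> \<in> borel_measurable P" and "n \<ge> 1"
  defines "U \<equiv> exceedance \<phi> u" and "A \<equiv> escape_set f \<phi> q u"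
  shows "\<bar>prob {x. running_max f \<phi> n x \<le> u} - prob (avoid A n)\<bar> \<le> q * prob U"
proof -
  have U: "U \<in> sets P" and A: "A \<in> sets P"
    unfolding U_def A_def using phi by (auto intro: exceedance_sets escape_set_sets)
  \<comment> \<open>As \<open>n \<ge> 1\<close>, the \<open>Max\<close> is over a nonempty
    set.\<close>
  have M: "{x. running_max f \<phi> n x \<le> u} = avoid U n"
    using \<open>n \<ge> 1\<close> by (auto simp: running_max_def avoid_def U_def exceedance_def not_less lessThan_empty_iff)
  have sub: "avoid U n \<subseteq> avoid A n"
    by (auto simp: avoid_def A_def U_def escape_set_def)
  \<comment> \<open>If \<open>q \<ge> n\<close>, truncated subtraction makes the union run over all
    times below \<open>n\<close>.\<close>
  have "avoid A n \<subseteq> avoid U n \<union> (\<Union>i\<in>{n - q..<n}. (f ^^ i) -` U)"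
  proof
    fix x assume x: "x \<in> avoid A n"
    show "x \<in> avoid U n \<union> (\<Union>i\<in>{n - q..<n}. (f ^^ i) -` U)"
    proof (rule ccontr)
      assume neg: "x \<notin> avoid U n \<union> (\<Union>i\<in>{n - q..<n}. (f ^^ i) -` U)"
      define I where "I = {i. i < n \<and> (f ^^ i) x \<in> U}"
      define i where "i = Max I"
      have "finite I" by (simp add: I_def)
      moreover have "I \<noteq> {}" using neg by (auto simp: I_def avoid_def)
      ultimately have i: "i \<in> I" "\<And>j. j \<in> I \<Longrightarrow> j \<le> i" by (simp_all add: i_def)
      \<comment> \<open>The last exceedance time \<open>i\<close> is followed by \<open>q\<close>
        times still below \<open>n\<close>, all without exceedance, hence it is an escape.\<close>
      have "i < n - q" using i(1) neg by (auto simp: I_def not_le)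
      have "(f ^^ j) ((f ^^ i) x) \<notin> U" if "j \<in> {1..q}" for j
      proof -
        have "j + i < n" using that \<open>i < n - q\<close> by auto
        then show ?thesis using i(2)[of "j + i"] that by (auto simp: I_def funpow_add)
      qed
      then have "(f ^^ i) x \<in> A"
        using i(1) by (auto simp: A_def U_def escape_set_def I_def)
      then show False using x i(1) by (auto simp: avoid_def I_def)
    qed
  qed
  then have "prob (avoid A n) \<le> prob (avoid U n \<union> (\<Union>i\<in>{n - q..<n}. (f ^^ i) -` U))"
    using U by (intro finite_measure_mono) auto
  also have "\<dots> \<le> prob (avoid U n) + prob (\<Union>i\<in>{n - q..<n}. (f ^^ i) -` U)"
    using U by (intro measure_Un_le) auto
  also have "prob (\<Union>i\<in>{n - q..<n}. (f ^^ i) -` U) \<le> (\<Sum>i\<in>{n - q..<n}. prob ((f ^^ i) -` U))"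
    using U by (intro finite_measure_subadditive_finite) auto
  also have "\<dots> \<le> q * prob U"
    using U by (simp add: mult_right_mono)
  finally show ?thesis
    using finite_measure_mono[OF sub avoid_sets[OF A]] by (simp add: M)
qed

section \<open>Decay of correlations for events\<close>

text \<open>The indicator of \<open>A\<close> is the Banach space observable, that of
  \<open>D\<close> the integrable one; the \<open>L\<^sup>1\<close> norm of the latter is
  \<open>prob D\<close>.\<close>

lemma prob_inter_decay:
  assumes decay: "decay_of_correlations_L1 P f C N \<gamma>"
    and A: "A \<in> sets P" "0 < prob A" "indicator A \<in> C" "N (indicator A) \<le> B"
    and D: "D \<in> sets P" and "1 \<le> j" "0 \<le> \<gamma> j"
  shows "\<bar>prob (A \<inter> (f ^^ j) -` D) - prob A * prob D\<bar> \<le> B * \<gamma> j * prob D"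
proof (cases "prob D = 0")
  \<comment> \<open>The decay hypothesis excludes observables of norm zero; for null
    \<open>D\<close> both sides vanish.\<close>
  case True
  have "prob (A \<inter> (f ^^ j) -` D) \<le> prob ((f ^^ j) -` D)"
    using D by (intro finite_measure_mono) auto
  then have "prob (A \<inter> (f ^^ j) -` D) = 0"
    using True D measure_nonneg[of P "A \<inter> (f ^^ j) -` D"] by simp
  then show ?thesis using True by simp
next
  case False
  have N: "0 \<le> N (indicator A)" "N (indicator A) = 0 \<longrightarrow> (AE x in P. indicator A x = (0::real))"
    using decay A(3) unfolding decay_of_correlations_L1_def banach_function_space_def by auto
  \<comment> \<open>Only almost everywhere vanishing functions may have norm zero, so
    \<open>prob A > 0\<close> makes the norm of the indicator positive.\<close>
  have "\<not> (AE x in P. indicator A x = (0::real))"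
  proof
    assume "AE x in P. indicator A x = (0::real)"
    then have "AE x in P. x \<notin> A" by (simp add: indicator_def)
    then have "prob A = 0"
      using A(1) by (simp add: prob_eq_0)
    then show False using A(2) by simp
  qed
  then have Npos: "0 < N (indicator A)" using N by auto
  have abs_int: "(LINT x|P. \<bar>indicator D x :: real\<bar>) = prob D"
    using D by simp
  have prod: "(\<lambda>x. indicator A x * (indicator D ((f ^^ j) x) :: real)) = indicator (A \<inter> (f ^^ j) -` D)"
    by (auto simp: indicator_def)
  have "integrable P (indicator D :: 'a \<Rightarrow> real)"
    using D by (simp add: emeasure_eq_measure)
  then have "1 / (N (indicator A) * (LINT x|P. \<bar>indicator D x :: real\<bar>)) *
      \<bar>(LINT x|P. indicator A x * indicator D ((f ^^ j) x))
        - (LINT x|P. indicator A x) * (LINT x|P. indicator D x)\<bar> \<le> \<gamma> j"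
    using decay[unfolded decay_of_correlations_L1_def, THEN conjunct2, THEN conjunct2, THEN conjunct2,
        rule_format, of "indicator A" "indicator D" j] A(3) Npos False \<open>1 \<le> j\<close> abs_int
    by simp
  moreover have "(LINT x|P. indicator A x * indicator D ((f ^^ j) x)) = prob (A \<inter> (f ^^ j) -` D)"
    unfolding prod using A D by (simp add: vimage_funpow_sets)
  ultimately have "1 / (N (indicator A) * prob D) *
      \<bar>prob (A \<inter> (f ^^ j) -` D) - prob A * prob D\<bar> \<le> \<gamma> j"
    using A D abs_int by simp
  moreover have Dpos: "0 < prob D" using False by (simp add: less_le)
  ultimately have "\<bar>prob (A \<inter> (f ^^ j) -` D) - prob A * prob D\<bar> \<le> \<gamma> j * (N (indicator A) * prob D)"
    using Npos by (simp add: divide_le_eq)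
  also have "\<dots> \<le> \<gamma> j * (B * prob D)"
    using A(4) Dpos \<open>0 \<le> \<gamma> j\<close> by (intro mult_left_mono mult_right_mono) auto
  finally show ?thesis by (simp add: algebra_simps)
qed

text \<open>Lags before the first return contribute nothing to the double visits, so the sum of
  \<open>\<gamma>\<close> may start there.\<close>

lemma prob_inter_return:
  assumes "enat j < first_return f A" "1 \<le> j"
  shows "A \<inter> (f ^^ j) -` A = {}"
proof (rule ccontr)
  assume "A \<inter> (f ^^ j) -` A \<noteq> {}"
  then obtain x where x: "x \<in> A" "(f ^^ j) x \<in> A" by auto
  have "first_return f A \<le> hitting_time f A x"
    unfolding first_return_def using x by (intro INF_lower)
  also have "\<dots> \<le> enat j"
    unfolding hitting_time_def using x assms by (intro INF_lower) auto
  finally show False using assms by simp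
qed

section \<open>Exponential approximation with explicit constants\<close>

text \<open>Four errors are added: the block iteration, the \<open>n mod k\<close> leftover times,
  the power against the exponential, and the exponent against \<open>s\<close>. The factor 4 is 1 +
  1 + 2 from the first, second and fourth; the factor 2 is 1 + 1 from the first and third.\<close>

lemma prob_avoid_exp:
  fixes \<gamma> :: "nat \<Rightarrow> real" and B s :: real and k t l n :: nat
  assumes A: "A \<in> sets P"
    and mono: "\<And>i j. 1 \<le> i \<Longrightarrow> i \<le> j \<Longrightarrow> \<gamma> j \<le> \<gamma> i" and nonneg: "\<And>j. 1 \<le> j \<Longrightarrow> 0 \<le> \<gamma> j"
    and mix: "\<And>D j. D \<in> sets P \<Longrightarrow> 1 \<le> j \<Longrightarrow>
      \<bar>prob (A \<inter> (f ^^ j) -` D) - prob A * prob D\<bar> \<le> B * \<gamma> j * prob D"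
    and "0 \<le> B" and kt: "1 \<le> k" "1 \<le> t" "k * t < n" and l: "l = n div k - t"
    and small: "n * prob A \<le> k" and "0 \<le> s"
  shows "\<bar>prob (avoid A n) - exp (- s)\<bar> \<le> \<bar>s - n * prob A\<bar> + 4 * (k * t * prob A)
    + B * (n * \<gamma> t) + 2 * ((n * prob A)\<^sup>2 / k)
    + B * (n * prob A * (\<Sum>j | first_return f A \<le> enat j \<and> j < l. \<gamma> j))"
proof -
  define a where "a = prob A"
  define \<Sigma> where "\<Sigma> = (\<Sum>j | first_return f A \<le> enat j \<and> j < l. \<gamma> j)"
  \<comment> \<open>Double visits in a block: a product term for each lag, plus the decay error for
    lags from the first return on.\<close>
  define S where "S = l * a\<^sup>2 + B * a * \<Sigma>"
  have a: "0 \<le> a" by (simp add: a_def)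
  \<comment> \<open>Hence the subtraction defining \<open>l\<close> is not truncated.\<close>
  have "t \<le> n div k"
    using kt by (simp add: less_eq_div_iff_mult_less_eq mult.commute)
  then have h: "l + t = n div k" using l by simp
  have n_eq: "n = k * (l + t) + n mod k" by (simp add: h)
  have "k * l \<le> n" by (subst n_eq) (simp add: algebra_simps)
  then have kl: "real k * real l \<le> real n" by (simp flip: of_nat_mult)
  have k_pos: "0 < real k" using kt by simp
  have "n mod k \<le> k" using kt by (simp add: less_imp_le)
  also have "k \<le> k * t" using kt by simp
  finally have n_mod: "n mod k \<le> k * t" .
  have la_nk: "l * a \<le> n * a / k"
    using mult_right_mono[OF kl a] k_pos by (simp add: pos_le_divide_eq mult_ac)
  have la: "l * a \<le> 1"
    using la_nk small k_pos by (smt (verit) a_def divide_le_eq_1_pos)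
  have index: "{j \<in> {1..<l}. first_return f A \<le> enat j} = {j. first_return f A \<le> enat j \<and> j < l}"
    using one_le_first_return[of f A] by (auto simp: one_enat_def dest: order_trans)
  have S: "(\<Sum>j\<in>{1..<l}. prob (A \<inter> (f ^^ j) -` A)) \<le> S"
  proof -
    have "(\<Sum>j\<in>{1..<l}. prob (A \<inter> (f ^^ j) -` A))
        \<le> (\<Sum>j\<in>{1..<l}. a\<^sup>2 + (if first_return f A \<le> enat j then B * a * \<gamma> j else 0))"
    proof (intro sum_mono)
      fix j assume j: "j \<in> {1..<l}"
      show "prob (A \<inter> (f ^^ j) -` A) \<le> a\<^sup>2 + (if first_return f A \<le> enat j then B * a * \<gamma> j else 0)"
      proof (cases "first_return f A \<le> enat j")
        case True
        then show ?thesis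
          using mix[OF A, of j] j by (simp add: a_def power2_eq_square algebra_simps)
      next
        case False
        then show ?thesis
          using prob_inter_return[of j A] j by simp
      qed
    qed
    also have "\<dots> = (l - 1) * a\<^sup>2 + B * a * \<Sigma>"
      unfolding sum.distrib \<Sigma>_def index[symmetric] sum_distrib_left
        sum.inter_filter[OF finite_atLeastLessThan] sum_constant card_atLeastLessThan
      by (intro arg_cong2[of _ _ _ _ "(+)"] sum.cong refl) simp
    also have "\<dots> \<le> S"
      unfolding S_def by (intro add_right_mono mult_right_mono) auto
    finally show ?thesis .
  qed
  \<comment> \<open>Monotonicity of \<open>\<gamma>\<close> and \<open>prob D \<le> 1\<close> give
    one error valid for every lag beyond the gap.\<close>
  have mix': "\<bar>prob (A \<inter> (f ^^ j) -` D) - prob A * prob D\<bar> \<le> B * \<gamma> t"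
    if D: "D \<in> sets P" and j: "t < j" for D j
  proof -
    have "B * \<gamma> j * prob D \<le> B * \<gamma> j * 1"
      using \<open>0 \<le> B\<close> nonneg[of j] j by (intro mult_left_mono) auto
    also have "\<dots> \<le> B * \<gamma> t"
      using \<open>0 \<le> B\<close> mono[of t j] j kt by (simp add: mult_left_mono)
    finally show ?thesis using mix[OF D, of j] j by simp
  qed
  have "\<Sigma> \<ge> 0"
    unfolding \<Sigma>_def index[symmetric] using nonneg by (intro sum_nonneg) auto
  then have "0 \<le> S" using a \<open>0 \<le> B\<close> by (simp add: S_def)
  have blocks: "\<bar>prob (avoid A (k * (l + t))) - (1 - l * a) ^ k\<bar> \<le> k * (t * a + l * (B * \<gamma> t + S))"
    unfolding a_def using prob_avoid_blocks[OF A _ mix' S] la by (simp add: a_def)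
  also have "\<dots> = k * t * a + (k * l) * (B * \<gamma> t + S)" by (simp add: algebra_simps)
  also have "\<dots> \<le> k * t * a + n * (B * \<gamma> t + S)"
    using kl \<open>0 \<le> S\<close> \<open>0 \<le> B\<close> nonneg[of t] kt by (intro add_left_mono mult_right_mono) auto
  also have "\<dots> \<le> k * t * a + B * (n * \<gamma> t) + (n * a)\<^sup>2 / k + B * (n * a * \<Sigma>)"
  proof -
    \<comment> \<open>With \<open>n\<close> observed times in total, the product terms cost
      \<open>n * l * a\<^sup>2\<close>, and \<open>l\<close> is at most
      \<open>n / k\<close>.\<close>
    have "(n * a) * (l * a) \<le> (n * a) * (n * a / k)"
      using la_nk a by (intro mult_left_mono) auto
    then show ?thesis by (simp add: S_def algebra_simps power2_eq_square)
  qed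
  finally have 1: "\<bar>prob (avoid A (k * (l + t))) - (1 - l * a) ^ k\<bar>
      \<le> k * t * a + B * (n * \<gamma> t) + (n * a)\<^sup>2 / k + B * (n * a * \<Sigma>)" .
  have "real (n mod k) * a \<le> k * t * a"
    using n_mod a by (intro mult_right_mono) (simp_all flip: of_nat_mult)
  moreover have "\<bar>prob (avoid A n) - prob (avoid A (k * (l + t)))\<bar> \<le> real (n mod k) * a"
    using prob_avoid_add[OF A sets.top, of "k * (l + t)" "n mod k"] n_eq
    by (simp add: space_UNIV a_def abs_le_iff)
  ultimately have 2: "\<bar>prob (avoid A n) - prob (avoid A (k * (l + t)))\<bar> \<le> k * t * a" by simp
  have "k * (l * a)\<^sup>2 \<le> k * (n * a / k)\<^sup>2"
    using la_nk a by (intro mult_left_mono power_mono) auto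
  also have "\<dots> = (n * a)\<^sup>2 / k" using k_pos by (simp add: power2_eq_square)
  finally have 3: "\<bar>(1 - l * a) ^ k - exp (- (k * (l * a)))\<bar> \<le> (n * a)\<^sup>2 / k"
    using power_exp_diff[of "l * a" k] la a by simp
  \<comment> \<open>The unobserved times are the gaps, \<open>k * t\<close> in number, and fewer
    than \<open>k\<close> leftover ones.\<close>
  have "real n - real k * real l \<le> 2 * (k * t)"
  proof -
    have "real n = real k * (real l + real t) + real (n mod k)"
      using n_eq by (metis of_nat_add of_nat_mult)
    moreover have "real (n mod k) \<le> real k * real t"
      using n_mod by (simp flip: of_nat_mult)
    ultimately show ?thesis by (simp add: algebra_simps)
  qed
  then have "(real n - real k * real l) * a \<le> 2 * (k * t) * a"
    using a by (intro mult_right_mono) auto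
  moreover have "k * (l * a) \<le> n * a"
    using kl a by (simp add: mult_right_mono flip: mult.assoc)
  ultimately have 4: "\<bar>exp (- (k * (l * a))) - exp (- s)\<bar> \<le> \<bar>s - n * a\<bar> + 2 * (k * t * a)"
    using exp_neg_diff[of "k * (l * a)" s] a \<open>0 \<le> s\<close> by (simp add: algebra_simps)
  show ?thesis
    unfolding a_def[symmetric] \<Sigma>_def[symmetric] using 1 2 3 4 by linarith
qed

end

section \<open>Asymptotics along the levels and the final constant\<close>

text \<open>The last sum ranges over a set of lags because \<open>R n\<close> may be infinite, in
  which case it is empty.\<close>

theorem theorem3p7:
  fixes Atl :: "('a::{t2_space, second_countable_topology}, 'e::euclidean_space) chart set"
    and g :: "('a, 'e) chart \<Rightarrow> 'a \<Rightarrow> 'e \<Rightarrow> 'e \<Rightarrow> real"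
    and P :: "'a measure"
    and f :: "'a \<Rightarrow> 'a"
    and \<phi> :: "'a \<Rightarrow> ereal"
    and \<zeta> :: 'a
    and C :: "('a \<Rightarrow> real) set"
    and N :: "('a \<Rightarrow> real) \<Rightarrow> real"
    and \<gamma> :: "nat \<Rightarrow> real"
    and \<delta> \<tau> \<theta> B :: real
    and u :: "nat \<Rightarrow> real"
    and q :: nat
    and A :: "nat \<Rightarrow> nat \<Rightarrow> 'a set"
    and R :: "nat \<Rightarrow> enat"
    and k t l :: "nat \<Rightarrow> nat"
  assumes manifold: "riemannian_manifold Atl g"
    and prob: "prob_space P" and sets_P: "sets P = sets borel"
    and f_meas: "f \<in> measurable P P" and f_inv: "distr P P f = P"
    and phi_meas: "\<phi> \<in> borel_measurable P"
    and phi_max: "\<forall>x. \<phi> x \<le> \<phi> \<zeta>"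
    and R1: "regularity_R1 Atl g P \<phi> \<zeta>"
    and R2: "regularity_R2 P f \<phi> \<zeta>"
    and decay: "decay_of_correlations_L1 P f C N \<gamma>"
    and delta: "\<delta> > 0" "(\<lambda>n. real n powr (1 + \<delta>) * \<gamma> n) \<longlonglongrightarrow> 0"
    and tau: "\<tau> > 0" "(\<lambda>n. real n * measure P (exceedance \<phi> (u n))) \<longlonglongrightarrow> \<tau>"
    and A_def: "\<And>j n. A j n = escape_set f \<phi> j (u n)"
    and q_ex: "\<exists>j. (\<lambda>n. first_return f (A j n)) \<longlonglongrightarrow> \<infinity>"
    and q_def: "q = (LEAST j. (\<lambda>n. first_return f (A j n)) \<longlonglongrightarrow> \<infinity>)"
    and R_def: "\<And>n. R n = first_return f (A q n)"
    and kt: "\<And>n. n \<ge> 2 \<Longrightarrow> 1 \<le> k n \<and> 1 \<le> t n \<and> k n * t n < n"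
    and kt_inf: "\<And>n. n \<ge> 2 \<Longrightarrow>
          block_cost \<gamma> n (measure P (A q n)) (k n) (t n) =
          (INF (k', t') \<in> {(k', t'). 1 \<le> k' \<and> 1 \<le> t' \<and> k' * t' < n}.
             block_cost \<gamma> n (measure P (A q n)) k' t')"
    and l_def: "\<And>n. l n = n div k n - t n"
    and indic: "B > 0" "\<And>n. n \<ge> 1 \<Longrightarrow> indicator (A q n) \<in> C \<and> N (indicator (A q n)) \<le> B"
    and theta: "(\<lambda>n. measure P (A q n) / measure P (exceedance \<phi> (u n))) \<longlonglongrightarrow> \<theta>"
    and theta_pos: "\<theta> > 0"
  shows "\<exists>K>0. \<forall>\<^sub>F n in sequentially.
           \<bar>measure P {x. running_max f \<phi> n x \<le> u n} - exp (- \<theta> * \<tau>)\<bar>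
           \<le> K * exp (- \<theta> * \<tau>) *
              (\<bar>\<theta> * \<tau> - real n * measure P (A q n)\<bar>
               + real (k n * t n) * (\<theta> * \<tau> / real n)
               + real n * \<gamma> (t n) * (1 + \<theta> * \<tau> / real (k n))
               + (\<theta> * \<tau>)\<^sup>2 / real (k n)
               + \<theta> * \<tau> * (\<Sum>j | R n \<le> enat j \<and> j < l n. \<gamma> j))"
proof -
  interpret measure_preserving_map P f
    using prob f_meas f_inv sets_eq_imp_space_eq[OF sets_P]
    by (intro measure_preserving_map.intro measure_preserving_map_axioms.intro) simp_all
  define s where "s = \<theta> * \<tau>"
  have s: "0 < s" using tau(1) theta_pos by (simp add: s_def)
  define U where "U n = exceedance \<phi> (u n)" for n
  define a where "a n = prob (A q n)" for n
  have A_sets: "A q n \<in> sets P" for n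
    using escape_set_sets[OF phi_meas] by (simp add: A_def)
  have mono: "\<gamma> j \<le> \<gamma> i" if "1 \<le> i" "i \<le> j" for i j
    using decay that by (auto simp: decay_of_correlations_L1_def)
  \<comment> \<open>A non-increasing sequence with limit 0 is nonnegative.\<close>
  have nonneg: "0 \<le> \<gamma> j" if "1 \<le> j" for j
  proof (rule LIMSEQ_le_const2)
    show "\<gamma> \<longlonglongrightarrow> 0" using decay by (simp add: decay_of_correlations_L1_def)
    show "\<exists>N. \<forall>n\<ge>N. \<gamma> n \<le> \<gamma> j" using mono that by blast
  qed
  \<comment> \<open>Not yet simplified to \<open>n * a n\<close>: the cancellation needs
    \<open>prob (U n) \<noteq> 0\<close>, which \<open>ev_ratio\<close> supplies since division by 0
    yields 0.\<close>
  have prod: "(\<lambda>n. n * prob (U n) * (a n / prob (U n))) \<longlonglongrightarrow> s"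
    using tendsto_mult[OF tau(2) theta] by (simp add: U_def a_def s_def mult.commute)
  have ev_ratio: "\<forall>\<^sub>F n in sequentially. 0 < a n / prob (U n)"
    using order_tendstoD(1)[OF theta theta_pos] by (simp add: a_def U_def)
  have ev_U: "\<forall>\<^sub>F n in sequentially. n * prob (U n) < 2 * \<tau>"
    using order_tendstoD(2)[OF tau(2)] tau(1) by (simp add: U_def)
  have ev_na: "\<forall>\<^sub>F n in sequentially. n * prob (U n) * (a n / prob (U n)) < 2 * s"
    using order_tendstoD(2)[OF prod] s by simp
  \<comment> \<open>\<open>K\<close> dominates every coefficient arising below:
    \<open>8 + 2 * real q / \<theta>\<close>, \<open>B\<close>, \<open>8\<close> and
    \<open>2 * B\<close> in the main case, \<open>2 / s\<close> in the trivial one.\<close>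
  define K where "K = 9 + 2 * real q / \<theta> + 2 * B + 2 / s"
  have K: "1 \<le> K" "8 + 2 * real q / \<theta> \<le> K" "B \<le> K" "8 \<le> K" "2 * B \<le> K" "2 / s \<le> K"
    using theta_pos indic(1) s by (auto simp: K_def)
  show ?thesis
  \<comment> \<open>The factor \<open>exp s\<close> cancels the
    \<open>exp (- \<theta> * \<tau>)\<close> in front of the error terms.\<close>
  proof (intro exI[of _ "K * exp s"] conjI)
    show "0 < K * exp s" using K by simp
    show "\<forall>\<^sub>F n in sequentially.
           \<bar>prob {x. running_max f \<phi> n x \<le> u n} - exp (- \<theta> * \<tau>)\<bar>
           \<le> K * exp s * exp (- \<theta> * \<tau>) *
              (\<bar>\<theta> * \<tau> - real n * prob (A q n)\<bar>
               + real (k n * t n) * (\<theta> * \<tau> / real n)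
               + real n * \<gamma> (t n) * (1 + \<theta> * \<tau> / real (k n))
               + (\<theta> * \<tau>)\<^sup>2 / real (k n)
               + \<theta> * \<tau> * (\<Sum>j | R n \<le> enat j \<and> j < l n. \<gamma> j))"
      using eventually_ge_at_top[of 2] ev_ratio ev_U ev_na
    proof eventually_elim
      case (elim n)
      have a_pos: "0 < a n"
        using elim(2) by (metis a_def measure_nonneg zero_less_divide_iff not_less)
      have na: "n * a n \<le> 2 * s" using elim(2,4) by (simp split: if_splits)
      have kt_n: "1 \<le> k n" "1 \<le> t n" "k n * t n < n" using kt[OF elim(1)] by auto
      define k' where "k' = real (k n)"
      define T where "T = real (k n * t n)"
      define \<Sigma> where "\<Sigma> = (\<Sum>j | R n \<le> enat j \<and> j < l n. \<gamma> j)"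
      have k': "1 \<le> k'" and T: "1 \<le> T" and n: "2 \<le> real n"
        using kt_n elim(1) by (simp_all add: k'_def T_def Suc_le_eq flip: of_nat_mult)
      have \<gamma>t: "0 \<le> \<gamma> (t n)" using nonneg kt_n by simp
      have \<Sigma>: "0 \<le> \<Sigma>"
        unfolding \<Sigma>_def
      proof (intro sum_nonneg nonneg)
        fix j assume "j \<in> {j. R n \<le> enat j \<and> j < l n}"
        then have "1 \<le> enat j"
          using one_le_first_return[of f "A q n"] by (auto simp: R_def dest: order_trans)
        then show "1 \<le> j" by (simp add: one_enat_def)
      qed
      define E where "E = \<bar>s - n * a n\<bar> + T * (s / n) + n * \<gamma> (t n) * (1 + s / k')
        + s\<^sup>2 / k' + s * \<Sigma>"
      have terms: "0 \<le> T * (s / n)" "0 \<le> n * \<gamma> (t n) * (1 + s / k')" "0 \<le> s\<^sup>2 / k'" "0 \<le> s * \<Sigma>"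
        using T s k' \<gamma>t \<Sigma> n by auto
      have goal: "\<bar>prob {x. running_max f \<phi> n x \<le> u n} - exp (- s)\<bar> \<le> K * E"
      proof (cases "n * a n \<le> k'")
        case False
        \<comment> \<open>Two numbers in [0, 1] differ by at most 1, while
          \<open>s\<^sup>2 / k'\<close> is above \<open>s / 2\<close> here.\<close>
        then have "k' < 2 * s" using na by simp
        then have "1 \<le> (2 / s) * (s\<^sup>2 / k')"
          using s k' by (simp add: power2_eq_square divide_simps)
        also have "\<dots> \<le> K * (s\<^sup>2 / k')" using K terms by (intro mult_right_mono) auto
        also have "\<dots> \<le> K * E" using K terms by (intro mult_left_mono) (auto simp: E_def)
        finally have "1 \<le> K * E" .
        moreover have "\<bar>prob {x. running_max f \<phi> n x \<le> u n} - exp (- s)\<bar> \<le> 1"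
          using s by (simp add: abs_le_iff) (smt (verit) exp_gt_zero measure_nonneg prob_le_1 exp_le_one_iff)
        ultimately show ?thesis by linarith
      next
        case True
        have mix: "\<bar>prob (A q n \<inter> (f ^^ j) -` D) - prob (A q n) * prob D\<bar> \<le> B * \<gamma> j * prob D"
          if "D \<in> sets P" "1 \<le> j" for D j
          using prob_inter_decay[OF decay A_sets _ _ _ that] indic(2)[of n] a_pos nonneg that elim(1)
          by (simp add: a_def)
        \<comment> \<open>Here \<open>prob (U n)\<close> is below \<open>2 * \<tau> / n\<close>;
          dividing by \<open>\<theta>\<close> turns \<open>\<tau>\<close> into \<open>s\<close>, and
          \<open>T \<ge> 1\<close>.\<close>
        have 1: "q * prob (U n) \<le> (2 * real q / \<theta>) * (T * (s / n))"
        proof -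
          have "prob (U n) \<le> 2 * \<tau> / n"
            using elim(3) n by (simp add: pos_le_divide_eq mult.commute)
          also have "\<dots> \<le> 2 / \<theta> * (T * (s / n))"
            using T theta_pos tau(1) n by (simp add: s_def divide_simps)
          finally have "q * prob (U n) \<le> q * (2 / \<theta> * (T * (s / n)))"
            by (intro mult_left_mono) auto
          then show ?thesis by (simp add: algebra_simps)
        qed
        have 2: "4 * (T * a n) \<le> 8 * (T * (s / n))"
        proof -
          have "a n \<le> 2 * s / n" using na n by (simp add: pos_le_divide_eq mult.commute)
          then have "T * a n \<le> T * (2 * s / n)" using T by (intro mult_left_mono) auto
          then show ?thesis by simp
        qed
        have 3: "B * (n * \<gamma> (t n)) \<le> B * (n * \<gamma> (t n) * (1 + s / k'))"
          using indic(1) \<gamma>t s k' by (intro mult_left_mono) (simp_all add: algebra_simps)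
        \<comment> \<open>Squaring \<open>n * a n \<le> 2 * s\<close> gives the factor 4.\<close>
        have 4: "2 * ((n * a n)\<^sup>2 / k') \<le> 8 * (s\<^sup>2 / k')"
        proof -
          have "(n * a n)\<^sup>2 \<le> (2 * s)\<^sup>2" using na a_pos by (intro power_mono) auto
          then have "(n * a n)\<^sup>2 / k' \<le> (2 * s)\<^sup>2 / k'" using k' by (intro divide_right_mono) auto
          then show ?thesis by (simp add: power_mult_distrib)
        qed
        have 5: "B * (n * a n * \<Sigma>) \<le> (2 * B) * (s * \<Sigma>)"
        proof -
          have "n * a n * \<Sigma> \<le> 2 * s * \<Sigma>" using na \<Sigma> by (intro mult_right_mono)
          then have "B * (n * a n * \<Sigma>) \<le> B * (2 * s * \<Sigma>)"
            using indic(1) by (intro mult_left_mono) auto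
          then show ?thesis by (simp add: algebra_simps)
        qed
        have "\<bar>prob (avoid (A q n) n) - exp (- s)\<bar> \<le> \<bar>s - n * a n\<bar> + 4 * (T * a n)
            + B * (n * \<gamma> (t n)) + 2 * ((n * a n)\<^sup>2 / k') + B * (n * a n * \<Sigma>)"
          using prob_avoid_exp[OF A_sets mono nonneg mix _ kt_n l_def[of n], of s] True s indic(1)
          by (simp add: a_def T_def k'_def \<Sigma>_def R_def)
        moreover have "\<bar>prob {x. running_max f \<phi> n x \<le> u n} - prob (avoid (A q n) n)\<bar>
            \<le> q * prob (U n)"
          using prob_max_le_escape[OF phi_meas, of n "u n" q] elim(1) by (simp add: U_def A_def)
        ultimately have "\<bar>prob {x. running_max f \<phi> n x \<le> u n} - exp (- s)\<bar>
            \<le> \<bar>s - n * a n\<bar> + 4 * (T * a n) + B * (n * \<gamma> (t n)) + 2 * ((n * a n)\<^sup>2 / k')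
              + B * (n * a n * \<Sigma>) + q * prob (U n)"
          by linarith
        also have "\<dots> \<le> \<bar>s - n * a n\<bar> + 8 * (T * (s / n)) + B * (n * \<gamma> (t n) * (1 + s / k'))
              + 8 * (s\<^sup>2 / k') + (2 * B) * (s * \<Sigma>) + (2 * real q / \<theta>) * (T * (s / n))"
          using 1 2 3 4 5 by (intro add_mono) simp_all
        also have "\<dots> = 1 * \<bar>s - n * a n\<bar> + (8 + 2 * real q / \<theta>) * (T * (s / n))
              + B * (n * \<gamma> (t n) * (1 + s / k')) + 8 * (s\<^sup>2 / k') + (2 * B) * (s * \<Sigma>)"
          unfolding distrib_right[of 8] mult_1_left by (simp only: add_ac)
        also have "\<dots> \<le> K * \<bar>s - n * a n\<bar> + K * (T * (s / n))
              + K * (n * \<gamma> (t n) * (1 + s / k')) + K * (s\<^sup>2 / k') + K * (s * \<Sigma>)"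
          using K terms by (intro add_mono mult_right_mono) auto
        also have "\<dots> = K * E" by (simp add: E_def distrib_left)
        finally show ?thesis .
      qed
      have scale: "K * exp s * exp (- \<theta> * \<tau>) = K"
        using exp_minus_inverse[of s] by (simp add: s_def mult.assoc)
      then show ?case
        unfolding scale using goal
        unfolding E_def a_def T_def k'_def \<Sigma>_def s_def by simp
    qed
  qed
qed

end
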